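(* Let $D$ be a Prüfer domain, and let $I$ be an ideal of $D$. Then $I$ is idempotent (i.e. $I=I^2$) if and only if $I$ is a radical ideal each of whose minimal primes is idempotent.
   Context: A Prüfer domain is an integral domain in which every nonzero finitely generated ideal is invertible. A minimal prime of $I$ is a prime ideal minimal among the primes containing $I$. A radical ideal is an ideal equal to its radical; the ideal $D$ is regarded as a radical ideal with no minimal primes. *)

theory Defs
  imports "HOL-Algebra.Ideal_Product"
begin

section \<open>The field of fractions of a domain\<close>

text \<open>A fraction is an equivalence class of pairs (numerator, denominator).\<close>

definition fraction :: "('a, 'b) ring_scheme \<Rightarrow> 'a \<Rightarrow> 'a \<Rightarrow> ('a \<times> 'a) set" where
  "fraction R a b = {(c, d). c \<in> carrier R \<and> d \<in> carrier R - {\<zero>\<^bsub>R\<^esub>} \<and> a \<otimes>\<^bsub>R\<^esub> d = c \<otimes>\<^bsub>R\<^esub> b}"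

text \<open>The unions below range over all representatives; by \<open>frac_mult\<close> and \<open>frac_add\<close> the
  united classes all coincide.\<close>

definition fraction_field :: "('a, 'b) ring_scheme \<Rightarrow> ('a \<times> 'a) set ring" where
  "fraction_field R =
    \<lparr> carrier = {fraction R a b | a b. a \<in> carrier R \<and> b \<in> carrier R - {\<zero>\<^bsub>R\<^esub>}},
      mult = (\<lambda>u v. \<Union>{fraction R (a \<otimes>\<^bsub>R\<^esub> c) (b \<otimes>\<^bsub>R\<^esub> d) | a b c d.
                      (a, b) \<in> u \<and> (c, d) \<in> v}),
      one = fraction R \<one>\<^bsub>R\<^esub> \<one>\<^bsub>R\<^esub>,
      zero = fraction R \<zero>\<^bsub>R\<^esub> \<one>\<^bsub>R\<^esub>,
      add = (\<lambda>u v. \<Union>{fraction R (a \<otimes>\<^bsub>R\<^esub> d \<oplus>\<^bsub>R\<^esub> c \<otimes>\<^bsub>R\<^esub> b) (b \<otimes>\<^bsub>R\<^esub> d) | a b c d.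
                     (a, b) \<in> u \<and> (c, d) \<in> v}) \<rparr>"

definition frac_embed :: "('a, 'b) ring_scheme \<Rightarrow> 'a \<Rightarrow> ('a \<times> 'a) set" where
  "frac_embed R a = fraction R a \<one>\<^bsub>R\<^esub>"

context "domain"
begin

lemma frac_trans:
  assumes "a \<in> carrier R" "b \<in> carrier R - {\<zero>}" "c \<in> carrier R" "d \<in> carrier R - {\<zero>}"
    "e \<in> carrier R" "f \<in> carrier R - {\<zero>}"
    and "a \<otimes> d = c \<otimes> b" "c \<otimes> f = e \<otimes> d"
  shows "a \<otimes> f = e \<otimes> b"
proof -
  have "d \<otimes> (a \<otimes> f) = (a \<otimes> d) \<otimes> f" using assms(1-6) by (simp add: m_ac)
  also have "\<dots> = b \<otimes> (c \<otimes> f)" using assms by (simp add: m_ac)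
  also have "\<dots> = d \<otimes> (e \<otimes> b)" using assms by (simp add: m_ac)
  finally show ?thesis using assms(1-6) by (simp add: m_lcancel)
qed

lemma frac_self:
  assumes "a \<in> carrier R" "b \<in> carrier R - {\<zero>}"
  shows "(a, b) \<in> fraction R a b"
  using assms by (simp add: fraction_def)

lemma frac_eq_iff:
  assumes "a \<in> carrier R" "b \<in> carrier R - {\<zero>}" "c \<in> carrier R" "d \<in> carrier R - {\<zero>}"
  shows "fraction R a b = fraction R c d \<longleftrightarrow> a \<otimes> d = c \<otimes> b"
proof
  assume "fraction R a b = fraction R c d"
  then have "(c, d) \<in> fraction R a b" using frac_self[OF assms(3,4)] by simp
  then show "a \<otimes> d = c \<otimes> b" by (simp add: fraction_def)
next
  assume eq: "a \<otimes> d = c \<otimes> b"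
  show "fraction R a b = fraction R c d"
  proof (rule Set.set_eqI)
    fix x :: "'a \<times> 'a"
    obtain e f where x: "x = (e, f)" by fastforce
    show "x \<in> fraction R a b \<longleftrightarrow> x \<in> fraction R c d"
    proof
      assume "x \<in> fraction R a b"
      then have ef: "e \<in> carrier R" "f \<in> carrier R - {\<zero>}" "a \<otimes> f = e \<otimes> b"
        by (auto simp: x fraction_def)
      then show "x \<in> fraction R c d"
        using frac_trans[OF assms(3,4,1,2) ef(1,2) eq[symmetric] ef(3)]
        by (simp add: x fraction_def)
    next
      assume "x \<in> fraction R c d"
      then have ef: "e \<in> carrier R" "f \<in> carrier R - {\<zero>}" "c \<otimes> f = e \<otimes> d"
        by (auto simp: x fraction_def)
      then show "x \<in> fraction R a b"
        using frac_trans[OF assms ef(1,2) eq ef(3)] by (simp add: x fraction_def)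
    qed
  qed
qed

lemma frac_memD:
  assumes "(c, d) \<in> fraction R a b"
  shows "c \<in> carrier R" "d \<in> carrier R - {\<zero>}" "a \<otimes> d = c \<otimes> b"
  using assms by (auto simp: fraction_def)

lemma denom_mult:
  assumes "b \<in> carrier R - {\<zero>}" "d \<in> carrier R - {\<zero>}"
  shows "b \<otimes> d \<in> carrier R - {\<zero>}"
  using assms integral by auto

lemma frac_mult:
  assumes "a \<in> carrier R" "b \<in> carrier R - {\<zero>}" "c \<in> carrier R" "d \<in> carrier R - {\<zero>}"
  shows "fraction R a b \<otimes>\<^bsub>fraction_field R\<^esub> fraction R c d = fraction R (a \<otimes> c) (b \<otimes> d)"
proof -
  have "fraction R (a' \<otimes> c') (b' \<otimes> d') = fraction R (a \<otimes> c) (b \<otimes> d)"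
    if ab: "(a', b') \<in> fraction R a b" and cd: "(c', d') \<in> fraction R c d" for a' b' c' d'
  proof -
    note A = frac_memD[OF ab] and C = frac_memD[OF cd]
    have "(a' \<otimes> c') \<otimes> (b \<otimes> d) = (a' \<otimes> b) \<otimes> (c' \<otimes> d)"
      using A(1,2) C(1,2) assms by (simp add: m_ac)
    also have "\<dots> = (a \<otimes> b') \<otimes> (c \<otimes> d')" using A(3) C(3) by simp
    also have "\<dots> = (a \<otimes> c) \<otimes> (b' \<otimes> d')" using A(1,2) C(1,2) assms by (simp add: m_ac)
    finally show ?thesis
      using A(1,2) C(1,2) assms by (subst frac_eq_iff) (auto simp: integral_iff)
  qed
  then have "{fraction R (a' \<otimes> c') (b' \<otimes> d') | a' b' c' d'.
      (a', b') \<in> fraction R a b \<and> (c', d') \<in> fraction R c d} = {fraction R (a \<otimes> c) (b \<otimes> d)}"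
    using frac_self[OF assms(1,2)] frac_self[OF assms(3,4)] by blast
  then show ?thesis
    by (simp add: fraction_field_def)
qed

lemma frac_add:
  assumes "a \<in> carrier R" "b \<in> carrier R - {\<zero>}" "c \<in> carrier R" "d \<in> carrier R - {\<zero>}"
  shows "fraction R a b \<oplus>\<^bsub>fraction_field R\<^esub> fraction R c d
       = fraction R (a \<otimes> d \<oplus> c \<otimes> b) (b \<otimes> d)"
proof -
  have "fraction R (a' \<otimes> d' \<oplus> c' \<otimes> b') (b' \<otimes> d') = fraction R (a \<otimes> d \<oplus> c \<otimes> b) (b \<otimes> d)"
    if ab: "(a', b') \<in> fraction R a b" and cd: "(c', d') \<in> fraction R c d" for a' b' c' d'
  proof -
    note A = frac_memD[OF ab] and C = frac_memD[OF cd]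
    have "(a' \<otimes> d' \<oplus> c' \<otimes> b') \<otimes> (b \<otimes> d)
        = (a' \<otimes> b) \<otimes> (d' \<otimes> d) \<oplus> (c' \<otimes> d) \<otimes> (b' \<otimes> b)"
      using A(1,2) C(1,2) assms by (simp add: m_ac l_distr r_distr)
    also have "\<dots> = (a \<otimes> b') \<otimes> (d' \<otimes> d) \<oplus> (c \<otimes> d') \<otimes> (b' \<otimes> b)" using A(3) C(3) by simp
    also have "\<dots> = (a \<otimes> d \<oplus> c \<otimes> b) \<otimes> (b' \<otimes> d')"
      using A(1,2) C(1,2) assms by (simp add: m_ac l_distr r_distr)
    finally show ?thesis
      using A(1,2) C(1,2) assms by (subst frac_eq_iff) (auto simp: integral_iff)
  qed
  then have "{fraction R (a' \<otimes> d' \<oplus> c' \<otimes> b') (b' \<otimes> d') | a' b' c' d'.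
      (a', b') \<in> fraction R a b \<and> (c', d') \<in> fraction R c d} = {fraction R (a \<otimes> d \<oplus> c \<otimes> b) (b \<otimes> d)}"
    using frac_self[OF assms(1,2)] frac_self[OF assms(3,4)] by blast
  then show ?thesis
    by (simp add: fraction_field_def)
qed

lemma frac_carrierI:
  assumes "a \<in> carrier R" "b \<in> carrier R - {\<zero>}"
  shows "fraction R a b \<in> carrier (fraction_field R)"
  using assms by (auto simp: fraction_field_def)

lemma frac_carrierE:
  assumes "x \<in> carrier (fraction_field R)"
  obtains a b where "a \<in> carrier R" "b \<in> carrier R - {\<zero>}" "x = fraction R a b"
  using assms by (auto simp: fraction_field_def)

lemma fraction_field_zero: "\<zero>\<^bsub>fraction_field R\<^esub> = fraction R \<zero> \<one>"
  and fraction_field_one: "\<one>\<^bsub>fraction_field R\<^esub> = fraction R \<one> \<one>"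
  by (simp_all add: fraction_field_def)

lemma fraction_field_cring: "cring (fraction_field R)"
proof (rule cringI)
  let ?K = "fraction_field R"
  show "abelian_group ?K"
  proof (rule abelian_groupI)
    fix x y assume "x \<in> carrier ?K" "y \<in> carrier ?K"
    then obtain a b c d where *: "a \<in> carrier R" "b \<in> carrier R - {\<zero>}" "x = fraction R a b"
      "c \<in> carrier R" "d \<in> carrier R - {\<zero>}" "y = fraction R c d"
      by (elim frac_carrierE) (rule that; assumption)
    then show "x \<oplus>\<^bsub>?K\<^esub> y \<in> carrier ?K"
      by (simp add: frac_add frac_carrierI integral_iff)
  next
    show "\<zero>\<^bsub>?K\<^esub> \<in> carrier ?K" by (simp add: fraction_field_zero frac_carrierI)
  next
    fix x y z assume "x \<in> carrier ?K" "y \<in> carrier ?K" "z \<in> carrier ?K"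
    then obtain a b c d e f where *: "a \<in> carrier R" "b \<in> carrier R - {\<zero>}" "x = fraction R a b"
      "c \<in> carrier R" "d \<in> carrier R - {\<zero>}" "y = fraction R c d"
      "e \<in> carrier R" "f \<in> carrier R - {\<zero>}" "z = fraction R e f"
      by (elim frac_carrierE) (rule that; assumption)
    have eq: "(a \<otimes> d \<oplus> c \<otimes> b) \<otimes> f \<oplus> e \<otimes> (b \<otimes> d) = a \<otimes> (d \<otimes> f) \<oplus> (c \<otimes> f \<oplus> e \<otimes> d) \<otimes> b"
      "b \<otimes> d \<otimes> f = b \<otimes> (d \<otimes> f)"
      using * by (simp_all add: m_ac l_distr r_distr a_ac)
    show "x \<oplus>\<^bsub>?K\<^esub> y \<oplus>\<^bsub>?K\<^esub> z = x \<oplus>\<^bsub>?K\<^esub> (y \<oplus>\<^bsub>?K\<^esub> z)"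
      using * by (simp add: frac_add integral_iff eq)
  next
    fix x y assume "x \<in> carrier ?K" "y \<in> carrier ?K"
    then obtain a b c d where *: "a \<in> carrier R" "b \<in> carrier R - {\<zero>}" "x = fraction R a b"
      "c \<in> carrier R" "d \<in> carrier R - {\<zero>}" "y = fraction R c d"
      by (elim frac_carrierE) (rule that; assumption)
    then show "x \<oplus>\<^bsub>?K\<^esub> y = y \<oplus>\<^bsub>?K\<^esub> x"
      by (simp add: frac_add a_comm m_comm)
  next
    fix x assume "x \<in> carrier ?K"
    then obtain a b where *: "a \<in> carrier R" "b \<in> carrier R - {\<zero>}" "x = fraction R a b"
      by (elim frac_carrierE) (rule that; assumption)
    show "\<zero>\<^bsub>?K\<^esub> \<oplus>\<^bsub>?K\<^esub> x = x"
      using * by (simp add: fraction_field_zero frac_add)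
    have "fraction R (\<ominus> a) b \<oplus>\<^bsub>?K\<^esub> x = \<zero>\<^bsub>?K\<^esub>"
      using * by (simp add: fraction_field_zero frac_add frac_eq_iff integral_iff l_minus l_neg)
    moreover have "fraction R (\<ominus> a) b \<in> carrier ?K"
      using * by (simp add: frac_carrierI)
    ultimately show "\<exists>y\<in>carrier ?K. y \<oplus>\<^bsub>?K\<^esub> x = \<zero>\<^bsub>?K\<^esub>" by blast
  qed
  show "comm_monoid ?K"
  proof (rule comm_monoidI)
    fix x y assume "x \<in> carrier ?K" "y \<in> carrier ?K"
    then obtain a b c d where *: "a \<in> carrier R" "b \<in> carrier R - {\<zero>}" "x = fraction R a b"
      "c \<in> carrier R" "d \<in> carrier R - {\<zero>}" "y = fraction R c d"
      by (elim frac_carrierE) (rule that; assumption)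
    show "x \<otimes>\<^bsub>?K\<^esub> y \<in> carrier ?K"
      using * by (simp add: frac_mult frac_carrierI integral_iff)
    show "x \<otimes>\<^bsub>?K\<^esub> y = y \<otimes>\<^bsub>?K\<^esub> x"
      using * by (simp add: frac_mult m_comm)
  next
    show "\<one>\<^bsub>?K\<^esub> \<in> carrier ?K" by (simp add: fraction_field_one frac_carrierI)
  next
    fix x y z assume "x \<in> carrier ?K" "y \<in> carrier ?K" "z \<in> carrier ?K"
    then obtain a b c d e f where *: "a \<in> carrier R" "b \<in> carrier R - {\<zero>}" "x = fraction R a b"
      "c \<in> carrier R" "d \<in> carrier R - {\<zero>}" "y = fraction R c d"
      "e \<in> carrier R" "f \<in> carrier R - {\<zero>}" "z = fraction R e f"
      by (elim frac_carrierE) (rule that; assumption)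
    then show "x \<otimes>\<^bsub>?K\<^esub> y \<otimes>\<^bsub>?K\<^esub> z = x \<otimes>\<^bsub>?K\<^esub> (y \<otimes>\<^bsub>?K\<^esub> z)"
      by (simp add: frac_mult integral_iff m_assoc)
  next
    fix x assume "x \<in> carrier ?K"
    then show "\<one>\<^bsub>?K\<^esub> \<otimes>\<^bsub>?K\<^esub> x = x"
      by (elim frac_carrierE) (simp add: fraction_field_one frac_mult)
  qed
  fix x y z assume "x \<in> carrier ?K" "y \<in> carrier ?K" "z \<in> carrier ?K"
  then obtain a b c d e f where *: "a \<in> carrier R" "b \<in> carrier R - {\<zero>}" "x = fraction R a b"
    "c \<in> carrier R" "d \<in> carrier R - {\<zero>}" "y = fraction R c d"
    "e \<in> carrier R" "f \<in> carrier R - {\<zero>}" "z = fraction R e f"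
    by (elim frac_carrierE) (rule that; assumption)
  have carr: "a \<in> carrier R" "b \<in> carrier R" "c \<in> carrier R" "d \<in> carrier R"
    "e \<in> carrier R" "f \<in> carrier R"
    using * by auto
  have df: "d \<otimes> f \<in> carrier R - {\<zero>}" and bf: "b \<otimes> f \<in> carrier R - {\<zero>}"
    and bd: "b \<otimes> d \<in> carrier R - {\<zero>}"
    using * denom_mult by blast+
  have "((a \<otimes> d \<oplus> c \<otimes> b) \<otimes> e) \<otimes> ((b \<otimes> f) \<otimes> (d \<otimes> f))
      = ((a \<otimes> e) \<otimes> (d \<otimes> f) \<oplus> (c \<otimes> e) \<otimes> (b \<otimes> f)) \<otimes> ((b \<otimes> d) \<otimes> f)"
    using carr by (simp add: m_ac l_distr r_distr)
  then have "fraction R ((a \<otimes> d \<oplus> c \<otimes> b) \<otimes> e) ((b \<otimes> d) \<otimes> f)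
      = fraction R ((a \<otimes> e) \<otimes> (d \<otimes> f) \<oplus> (c \<otimes> e) \<otimes> (b \<otimes> f)) ((b \<otimes> f) \<otimes> (d \<otimes> f))"
    using carr denom_mult[OF bd *(8)] denom_mult[OF bf df] by (subst frac_eq_iff) auto
  then show "(x \<oplus>\<^bsub>?K\<^esub> y) \<otimes>\<^bsub>?K\<^esub> z = x \<otimes>\<^bsub>?K\<^esub> z \<oplus>\<^bsub>?K\<^esub> y \<otimes>\<^bsub>?K\<^esub> z"
    using * carr bd bf df by (simp add: frac_add frac_mult del: Diff_iff)
qed

lemma fraction_field_is_field: "field (fraction_field R)"
proof -
  interpret K: cring "fraction_field R" by (rule fraction_field_cring)
  show ?thesis
  proof (rule K.cring_fieldI2)
    show "\<zero>\<^bsub>fraction_field R\<^esub> \<noteq> \<one>\<^bsub>fraction_field R\<^esub>"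
      by (simp add: fraction_field_zero fraction_field_one frac_eq_iff)
  next
    fix x assume x: "x \<in> carrier (fraction_field R)" "x \<noteq> \<zero>\<^bsub>fraction_field R\<^esub>"
    then obtain a b where *: "a \<in> carrier R" "b \<in> carrier R - {\<zero>}" "x = fraction R a b"
      by (elim frac_carrierE) (rule that; assumption)
    then have "a \<noteq> \<zero>"
      using x(2) by (auto simp: fraction_field_zero frac_eq_iff)
    then have "x \<otimes>\<^bsub>fraction_field R\<^esub> fraction R b a = \<one>\<^bsub>fraction_field R\<^esub>"
      "fraction R b a \<in> carrier (fraction_field R)"
      using * by (simp_all add: fraction_field_one frac_mult frac_eq_iff integral_iff m_comm
          frac_carrierI)
    then show "\<exists>y\<in>carrier (fraction_field R).
        x \<otimes>\<^bsub>fraction_field R\<^esub> y = \<one>\<^bsub>fraction_field R\<^esub>" by blast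
  qed
qed

lemma frac_embed_hom: "frac_embed R \<in> ring_hom R (fraction_field R)"
  by (rule ring_hom_memI)
     (simp_all add: frac_embed_def frac_carrierI frac_mult frac_add fraction_field_one)

lemma frac_embed_inj: "inj_on (frac_embed R) (carrier R)"
  by (rule inj_onI) (simp add: frac_embed_def frac_eq_iff)

end

section \<open>Invertible ideals and Pruefer domains\<close>

definition fractional_ideal :: "('a, 'b) ring_scheme \<Rightarrow> ('a \<times> 'a) set set \<Rightarrow> bool" where
  "fractional_ideal R J \<longleftrightarrow>
     additive_subgroup J (fraction_field R) \<and>
     (\<forall>r\<in>carrier R. \<forall>x\<in>J. frac_embed R r \<otimes>\<^bsub>fraction_field R\<^esub> x \<in> J) \<and>
     (\<exists>d\<in>carrier R - {\<zero>\<^bsub>R\<^esub>}. \<forall>x\<in>J.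
        frac_embed R d \<otimes>\<^bsub>fraction_field R\<^esub> x \<in> frac_embed R ` carrier R)"

text \<open>\<^const>\<open>ideal_prod\<close> is taken in the fraction field; there it forms the set of finite sums of
  products, which is the product of fractional ideals.\<close>

definition invertible_ideal :: "('a, 'b) ring_scheme \<Rightarrow> 'a set \<Rightarrow> bool" where
  "invertible_ideal R I \<longleftrightarrow> ideal I R \<and>
     (\<exists>J. fractional_ideal R J \<and>
        (frac_embed R ` I) \<cdot>\<^bsub>fraction_field R\<^esub> J = frac_embed R ` carrier R)"

definition finitely_generated_ideal :: "('a, 'b) ring_scheme \<Rightarrow> 'a set \<Rightarrow> bool" where
  "finitely_generated_ideal R I \<longleftrightarrow> (\<exists>S. finite S \<and> S \<subseteq> carrier R \<and> I = Idl\<^bsub>R\<^esub> S)"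

locale prufer_domain = "domain" R for R (structure) +
  assumes finitely_generated_invertible:
    "\<lbrakk> finitely_generated_ideal R I; I \<noteq> {\<zero>} \<rbrakk> \<Longrightarrow> invertible_ideal R I"

section \<open>Idempotent and radical ideals, minimal primes\<close>

definition idempotent_ideal :: "('a, 'b) ring_scheme \<Rightarrow> 'a set \<Rightarrow> bool" where
  "idempotent_ideal R I \<longleftrightarrow> ideal I R \<and> I = I \<cdot>\<^bsub>R\<^esub> I"

definition radical :: "('a, 'b) ring_scheme \<Rightarrow> 'a set \<Rightarrow> 'a set" where
  "radical R I = {x \<in> carrier R. \<exists>n::nat. n > 0 \<and> x [^]\<^bsub>R\<^esub> n \<in> I}"

definition radical_ideal :: "('a, 'b) ring_scheme \<Rightarrow> 'a set \<Rightarrow> bool" where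
  "radical_ideal R I \<longleftrightarrow> ideal I R \<and> I = radical R I"

text \<open>\<^const>\<open>primeideal\<close> requires properness, so the unit ideal has no minimal primes.\<close>

definition minimal_prime :: "('a, 'b) ring_scheme \<Rightarrow> 'a set \<Rightarrow> 'a set \<Rightarrow> bool" where
  "minimal_prime R I P \<longleftrightarrow> primeideal P R \<and> I \<subseteq> P \<and>
     (\<forall>Q. primeideal Q R \<and> I \<subseteq> Q \<and> Q \<subseteq> P \<longrightarrow> Q = P)"

end

theory Submission
  imports Defs "HOL-Algebra.Ring_Divisibility"
begin

text \<open>
  Instead of localizing at primes, where a Pruefer domain becomes a valuation ring, we use that any
  \<open>a\<close>, \<open>b\<close> admit \<open>s + t = 1\<close> with \<open>s a \<in> (b)\<close> and \<open>t b \<in> (a)\<close>.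

  Applied to all factors of an expression \<open>z = \<Sum> a\<^sub>i b\<^sub>i \<in> A B\<close> against a fixed \<open>x\<close>, this gives
  \<open>t\<close> with \<open>(1 - t) x \<in> A\<close> and \<open>t z \<in> x (A : x) B\<close>. If \<open>I = I\<^sup>2\<close> and \<open>x\<^sup>2 \<in> I\<close>, take \<open>z = x\<^sup>2\<close> and
  cancel \<open>x\<close>: both \<open>t x\<close> and \<open>(1 - t) x\<close> lie in \<open>I\<close>, so \<open>I\<close> is radical. If \<open>P\<close> is prime, \<open>u \<notin> P\<close>
  and \<open>u x \<in> P\<^sup>2\<close>, the same argument gives \<open>x \<in> P\<^sup>2\<close>.

  If \<open>I\<close> is radical and \<open>M\<close> is a prime containing \<open>I\<close>, the contraction of \<open>I D\<^sub>M\<close> is the unique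
  minimal prime of \<open>I\<close> inside \<open>M\<close>. So for a minimal prime \<open>P\<close> and \<open>x \<in> P\<close> some \<open>u \<notin> P\<close> has
  \<open>u x \<in> I = I\<^sup>2 \<subseteq> P\<^sup>2\<close>, whence \<open>x \<in> P\<^sup>2\<close>. Conversely, if \<open>x \<in> I\<close> and a maximal ideal \<open>M\<close> contained
  \<open>(I\<^sup>2 : x)\<close>, then idempotence of the contraction would produce \<open>u \<notin> M\<close> with \<open>u x \<in> I\<^sup>2\<close>.
\<close>

definition colon_ideal :: "('a, 'b) ring_scheme \<Rightarrow> 'a set \<Rightarrow> 'a \<Rightarrow> 'a set" where
  "colon_ideal R A x = {r \<in> carrier R. r \<otimes>\<^bsub>R\<^esub> x \<in> A}"

text \<open>For a prime \<open>M\<close> this is the contraction of the extension of \<open>I\<close> to the localization at \<open>M\<close>.\<close>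

definition contraction :: "('a, 'b) ring_scheme \<Rightarrow> 'a set \<Rightarrow> 'a set \<Rightarrow> 'a set" where
  "contraction R I M = {p \<in> carrier R. \<exists>u\<in>carrier R - M. u \<otimes>\<^bsub>R\<^esub> p \<in> I}"

section \<open>Ideals, contractions and radicals in a commutative ring\<close>

context cring
begin

lemma ideal_zero: "ideal A R \<Longrightarrow> \<zero> \<in> A"
  by (simp add: additive_subgroup.zero_closed ideal.axioms(1))

lemma ideal_add: "ideal A R \<Longrightarrow> a \<in> A \<Longrightarrow> b \<in> A \<Longrightarrow> a \<oplus> b \<in> A"
  by (simp add: additive_subgroup.a_closed ideal.axioms(1))

lemma idealI_cring:
  assumes "A \<subseteq> carrier R" "\<zero> \<in> A" "\<And>a b. a \<in> A \<Longrightarrow> b \<in> A \<Longrightarrow> a \<oplus> b \<in> A"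
    and l: "\<And>r a. r \<in> carrier R \<Longrightarrow> a \<in> A \<Longrightarrow> r \<otimes> a \<in> A"
  shows "ideal A R"
proof (rule idealI[OF ring_axioms])
  have "\<ominus> a \<in> A" if "a \<in> A" for a
    using l[of "\<ominus> \<one>" a] that assms(1) by (auto simp: l_minus)
  then show "subgroup A (add_monoid R)"
    using assms(1-3) by unfold_locales (auto simp: a_inv_def)
  show "x \<otimes> a \<in> A" if "a \<in> A" "x \<in> carrier R" for a x using that l by simp
  then show "a \<otimes> x \<in> A" if "a \<in> A" "x \<in> carrier R" for a x
    using that assms(1) by (metis m_comm subsetD)
qed

lemma colon_ideal_is_ideal:
  assumes "ideal A R" "x \<in> carrier R"
  shows "ideal (colon_ideal R A x) R"
  using assms
  by (intro idealI_cring)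
     (auto simp: colon_ideal_def l_distr m_assoc ideal_zero ideal_add ideal.I_l_closed)

lemma ex_maximalideal:
  assumes "ideal A R" "\<one> \<notin> A"
  obtains M where "maximalideal M R" "A \<subseteq> M"
proof -
  let ?S = "{M. ideal M R \<and> \<one> \<notin> M \<and> A \<subseteq> M}"
  have "\<exists>M\<in>?S. \<forall>X\<in>?S. M \<subseteq> X \<longrightarrow> X = M"
  proof (rule subset_Zorn_nonempty)
    show "?S \<noteq> {}" using assms by blast
    fix C assume C: "C \<noteq> {}" "subset.chain ?S C"
    then have "subset.chain {M. ideal M R} C"
      by (auto simp: pred_on.chain_def)
    then have "ideal (\<Union>C) R"
      using chain_Union_is_ideal[of C] C(1) by simp
    then show "\<Union>C \<in> ?S"
      using C by (auto simp: pred_on.chain_def)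
  qed
  then obtain M where M: "M \<in> ?S" and max: "\<forall>X\<in>?S. M \<subseteq> X \<longrightarrow> X = M" ..
  have "maximalideal M R"
  proof (rule maximalidealI)
    show "ideal M R" "carrier R \<noteq> M" using M by auto
    fix J assume J: "ideal J R" "M \<subseteq> J"
    show "J = M \<or> J = carrier R"
    proof (cases "\<one> \<in> J")
      case True
      then show ?thesis using ideal.one_imp_carrier[OF J(1)] by blast
    next
      case False
      then have "J \<in> ?S" using J M by auto
      then show ?thesis using max J(2) by simp
    qed
  qed
  then show thesis using M that by simp
qed

lemma one_notin_primeideal: "primeideal P R \<Longrightarrow> \<one> \<notin> P"
  using ideal.one_imp_carrier primeideal.I_notcarr primeideal.axioms(1) by blast

lemma primeideal_compl_mult:
  "primeideal P R \<Longrightarrow> u \<in> carrier R - P \<Longrightarrow> v \<in> carrier R - P \<Longrightarrow> u \<otimes> v \<in> carrier R - P"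
  using primeideal.I_prime by fastforce

lemma contraction_ideal:
  assumes I: "ideal I R" and M: "primeideal M R"
  shows "ideal (contraction R I M) R"
proof (rule idealI_cring)
  show "contraction R I M \<subseteq> carrier R" by (auto simp: contraction_def)
  show "\<zero> \<in> contraction R I M"
    using one_notin_primeideal[OF M] ideal_zero[OF I] by (auto simp: contraction_def intro!: bexI[of _ \<one>])
next
  fix a b assume "a \<in> contraction R I M" "b \<in> contraction R I M"
  then obtain u v where u: "u \<in> carrier R - M" "u \<otimes> a \<in> I" and v: "v \<in> carrier R - M" "v \<otimes> b \<in> I"
    and ab: "a \<in> carrier R" "b \<in> carrier R"
    by (auto simp: contraction_def)
  have "(u \<otimes> v) \<otimes> (a \<oplus> b) = v \<otimes> (u \<otimes> a) \<oplus> u \<otimes> (v \<otimes> b)"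
    using u(1) v(1) ab by (simp add: r_distr m_ac)
  also have "\<dots> \<in> I"
    using u v by (simp add: ideal_add[OF I] ideal.I_l_closed[OF I])
  finally show "a \<oplus> b \<in> contraction R I M"
    using ab primeideal_compl_mult[OF M u(1) v(1)] by (auto simp: contraction_def)
next
  fix r a assume r: "r \<in> carrier R" and "a \<in> contraction R I M"
  then obtain u where u: "u \<in> carrier R - M" "u \<otimes> a \<in> I" "a \<in> carrier R"
    by (auto simp: contraction_def)
  then have "u \<otimes> (r \<otimes> a) = r \<otimes> (u \<otimes> a)" using r by (simp add: m_ac)
  also have "\<dots> \<in> I" using ideal.I_l_closed[OF I] r u by blast
  finally show "r \<otimes> a \<in> contraction R I M"
    using r u by (auto simp: contraction_def)
qed

lemma contraction_superset:
  assumes "ideal I R" "primeideal M R"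
  shows "I \<subseteq> contraction R I M"
  using ideal.Icarr[OF assms(1)] one_notin_primeideal[OF assms(2)]
  by (auto simp: contraction_def intro!: bexI[of _ \<one>])

text \<open>A multiplier outside \<open>M\<close> is also outside \<open>Q\<close>, so primality of
  \<open>Q\<close> strips it off.\<close>

lemma contraction_subset:
  assumes "primeideal Q R" "I \<subseteq> Q" "Q \<subseteq> M"
  shows "contraction R I M \<subseteq> Q"
  using assms primeideal.I_prime[OF assms(1)] by (fastforce simp: contraction_def)

text \<open>The multipliers of two factors combine to \<open>u \<otimes> v\<close>, still outside
  \<open>M\<close> by primality. Sums are harmless because the contraction of
  \<open>I \<cdot> I\<close> is an ideal.\<close>

lemma contraction_prod:
  assumes I: "ideal I R" and M: "primeideal M R"
    and z: "z \<in> contraction R I M \<cdot> contraction R I M"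
  shows "z \<in> contraction R (I \<cdot> I) M"
  using z
proof (induct rule: ideal_prod.induct)
  case (prod a b)
  then obtain u v where u: "u \<in> carrier R - M" "u \<otimes> a \<in> I" and v: "v \<in> carrier R - M" "v \<otimes> b \<in> I"
    and ab: "a \<in> carrier R" "b \<in> carrier R"
    by (auto simp: contraction_def)
  have "(u \<otimes> v) \<otimes> (a \<otimes> b) = (u \<otimes> a) \<otimes> (v \<otimes> b)"
    using u(1) v(1) ab by (simp add: m_ac)
  also have "\<dots> \<in> I \<cdot> I" using u(2) v(2) by (rule ideal_prod.prod)
  finally show ?case
    using ab primeideal_compl_mult[OF M u(1) v(1)] by (auto simp: contraction_def)
next
  case (sum y z)
  then show ?case
    using ideal_add[OF contraction_ideal[OF ideal_prod_is_ideal[OF I I] M]] by blast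
qed

text \<open>The exponent descends one at a time: for \<open>n > 0\<close> the square of
  \<open>x [^] n\<close> is a multiple of \<open>x [^] Suc n\<close>, as
  \<open>2 * n = (n - 1) + Suc n\<close>.\<close>

lemma radicalI_square:
  assumes I: "ideal I R"
    and sq: "\<And>x. x \<in> carrier R \<Longrightarrow> x \<otimes> x \<in> I \<Longrightarrow> x \<in> I"
  shows "radical_ideal R I"
proof -
  have "x \<in> I" if "x [^] n \<in> I" "n > 0" and x: "x \<in> carrier R" for x and n :: nat
    using that(2,1)
  proof (induct n rule: nat_induct_non_zero)
    case 1
    then show ?case using x by simp
  next
    case (Suc n)
    then obtain m where n: "n = Suc m" by (cases n) auto
    have "x [^] n \<otimes> x [^] n = x [^] m \<otimes> x [^] Suc n"
      unfolding nat_pow_mult[OF x] by (simp add: n)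
    also have "\<dots> \<in> I" using ideal.I_l_closed[OF I] Suc x by simp
    finally have "x [^] n \<in> I" using sq[of "x [^] n"] x by simp
    then show ?case by (rule Suc.hyps(2))
  qed
  moreover have "x \<in> radical R I" if "x \<in> I" for x
    using ideal.Icarr[OF I that] that by (auto simp: radical_def intro!: exI[of _ "1::nat"])
  ultimately show ?thesis using I unfolding radical_ideal_def radical_def by blast
qed

lemma radical_ideal_square:
  assumes "radical_ideal R I" "x \<in> carrier R" "x \<otimes> x \<in> I"
  shows "x \<in> I"
proof -
  have "x [^] (2::nat) \<in> I" using assms by (simp add: numeral_2_eq_2)
  then have "x \<in> radical R I" using assms(2) by (auto simp: radical_def intro!: exI[of _ "2::nat"])
  then show ?thesis using assms(1) by (simp add: radical_ideal_def)
qed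

end

section \<open>Invertible ideals with two generators\<close>

context "domain"
begin

text \<open>Invertibility gives \<open>1 = a x + b y\<close> in the fraction field with
  \<open>x\<close>, \<open>y\<close> in the inverse \<open>J\<close>. The products
  \<open>s = b y\<close>, \<open>t = a x\<close>, \<open>c = a y\<close>, \<open>d = b x\<close> lie
  in the ring, and both relations are mere commutativity: \<open>s a = b (a y)\<close> and
  \<open>t b = a (b x)\<close>.\<close>

lemma invertible_ideal_pair:
  assumes a: "a \<in> carrier R" and b: "b \<in> carrier R" and inv: "invertible_ideal R (Idl {a, b})"
  obtains s t c d where "s \<in> carrier R" "t \<in> carrier R" "c \<in> carrier R" "d \<in> carrier R"
    "s \<oplus> t = \<one>" "s \<otimes> a = b \<otimes> c" "t \<otimes> b = a \<otimes> d"
proof -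
  let ?K = "fraction_field R" and ?f = "frac_embed R" and ?A = "Idl {a, b}"
  interpret K: cring ?K by (rule fraction_field_cring)
  interpret f: ring_hom_cring R ?K ?f
    using frac_embed_hom by unfold_locales
  obtain J where J: "fractional_ideal R J"
    and IJ: "(?f ` ?A) \<cdot>\<^bsub>?K\<^esub> J = ?f ` carrier R"
    using inv by (auto simp: invertible_ideal_def)
  interpret J: additive_subgroup J ?K using J by (simp add: fractional_ideal_def)
  have J_smult: "?f r \<otimes>\<^bsub>?K\<^esub> x \<in> J" if "r \<in> carrier R" "x \<in> J" for r x
    using J that by (simp add: fractional_ideal_def)
  have gen: "{a, b} \<subseteq> Idl {a, b}" using a b by (intro genideal_self) auto
  have Idl_form: "\<exists>r\<in>carrier R. \<exists>q\<in>carrier R. i = r \<otimes> a \<oplus> q \<otimes> b" if "i \<in> Idl {a, b}" for i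
  proof -
    have "Idl {a, b} \<subseteq> PIdl a <+> PIdl b"
    proof (rule genideal_minimal[OF add_ideals[OF cgenideal_ideal[OF a] cgenideal_ideal[OF b]]])
      have "a = a \<oplus> \<zero> \<otimes> b" "b = \<zero> \<otimes> a \<oplus> b" using a b by simp_all
      then show "{a, b} \<subseteq> PIdl a <+> PIdl b"
        using cgenideal_self[OF a] cgenideal_self[OF b]
        unfolding set_add_def' cgenideal_def by auto
    qed
    then show ?thesis using that by (fastforce simp: set_add_def' cgenideal_def)
  qed
  \<comment> \<open>Absorbing the ring coefficients into \<open>J\<close> collapses any finite sum
    of products to two terms.\<close>
  have form: "\<exists>x\<in>J. \<exists>y\<in>J. z = ?f a \<otimes>\<^bsub>?K\<^esub> x \<oplus>\<^bsub>?K\<^esub> ?f b \<otimes>\<^bsub>?K\<^esub> y"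
    if "z \<in> (?f ` ?A) \<cdot>\<^bsub>?K\<^esub> J" for z
    using that
  proof (induct rule: ideal_prod.induct)
    case (prod i j)
    then obtain r q where rq: "r \<in> carrier R" "q \<in> carrier R" "i = ?f (r \<otimes> a \<oplus> q \<otimes> b)"
      using Idl_form by blast
    have "i \<otimes>\<^bsub>?K\<^esub> j = ?f a \<otimes>\<^bsub>?K\<^esub> (?f r \<otimes>\<^bsub>?K\<^esub> j) \<oplus>\<^bsub>?K\<^esub> ?f b \<otimes>\<^bsub>?K\<^esub> (?f q \<otimes>\<^bsub>?K\<^esub> j)"
      using rq a b prod(2) by (simp add: K.l_distr K.r_distr K.m_ac)
    then show ?case using J_smult rq prod(2) by blast
  next
    case (sum z z')
    then obtain x y x' y' where *: "x \<in> J" "y \<in> J" "x' \<in> J" "y' \<in> J"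
      "z = ?f a \<otimes>\<^bsub>?K\<^esub> x \<oplus>\<^bsub>?K\<^esub> ?f b \<otimes>\<^bsub>?K\<^esub> y" "z' = ?f a \<otimes>\<^bsub>?K\<^esub> x' \<oplus>\<^bsub>?K\<^esub> ?f b \<otimes>\<^bsub>?K\<^esub> y'"
      by blast
    then have "z \<oplus>\<^bsub>?K\<^esub> z' = ?f a \<otimes>\<^bsub>?K\<^esub> (x \<oplus>\<^bsub>?K\<^esub> x') \<oplus>\<^bsub>?K\<^esub> ?f b \<otimes>\<^bsub>?K\<^esub> (y \<oplus>\<^bsub>?K\<^esub> y')"
      using a b by (simp add: K.r_distr K.a_ac)
    then show ?case using * J.a_closed by blast
  qed
  have "?f \<one> \<in> (?f ` ?A) \<cdot>\<^bsub>?K\<^esub> J" unfolding IJ by blast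
  then obtain x y where xy: "x \<in> J" "y \<in> J"
    and one: "?f \<one> = ?f a \<otimes>\<^bsub>?K\<^esub> x \<oplus>\<^bsub>?K\<^esub> ?f b \<otimes>\<^bsub>?K\<^esub> y"
    using form by blast
  have integral_mult: "\<exists>r\<in>carrier R. ?f c \<otimes>\<^bsub>?K\<^esub> z = ?f r" if "c \<in> {a, b}" "z \<in> J" for c z
    using ideal_prod.prod[of "?f c" "?f ` ?A" z J ?K] that gen IJ by blast
  obtain s t c d where carr: "s \<in> carrier R" "t \<in> carrier R" "c \<in> carrier R" "d \<in> carrier R"
    and eq: "?f b \<otimes>\<^bsub>?K\<^esub> y = ?f s" "?f a \<otimes>\<^bsub>?K\<^esub> x = ?f t" "?f a \<otimes>\<^bsub>?K\<^esub> y = ?f c" "?f b \<otimes>\<^bsub>?K\<^esub> x = ?f d"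
    using integral_mult[of b y] integral_mult[of a x] integral_mult[of a y] integral_mult[of b x] xy
    by blast
  have "s \<oplus> t = \<one>"
    by (rule inj_onD[OF frac_embed_inj]) (use carr one in \<open>simp_all add: eq K.a_comm\<close>)
  moreover have "s \<otimes> a = b \<otimes> c"
    by (rule inj_onD[OF frac_embed_inj])
       (use carr a b xy in \<open>simp_all add: eq[symmetric] K.m_ac\<close>)
  moreover have "t \<otimes> b = a \<otimes> d"
    by (rule inj_onD[OF frac_embed_inj])
       (use carr a b xy in \<open>simp_all add: eq[symmetric] K.m_ac\<close>)
  ultimately show thesis using carr that by blast
qed

end

section \<open>Splitting, radicals and minimal primes in a Pruefer domain\<close>

context prufer_domain
begin

text \<open>The Pruefer hypothesis enters here. It says nothing about the zero ideal, so
  \<open>a = b = 0\<close> gets the trivial splitting \<open>s = 1\<close>,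
  \<open>t = 0\<close>.\<close>

lemma pair_split:
  assumes a: "a \<in> carrier R" and b: "b \<in> carrier R"
  obtains s t c d where "s \<in> carrier R" "t \<in> carrier R" "c \<in> carrier R" "d \<in> carrier R"
    "s \<oplus> t = \<one>" "s \<otimes> a = b \<otimes> c" "t \<otimes> b = a \<otimes> d"
proof (cases "a = \<zero> \<and> b = \<zero>")
  case True
  then show thesis using that[of \<one> \<zero> \<zero> \<zero>] by simp
next
  case False
  have "{a, b} \<subseteq> Idl {a, b}" using a b by (intro genideal_self) auto
  then have "Idl {a, b} \<noteq> {\<zero>}" using False by auto
  moreover have "finitely_generated_ideal R (Idl {a, b})"
    using a b unfolding finitely_generated_ideal_def by (intro exI[of _ "{a, b}"]) auto
  ultimately have "invertible_ideal R (Idl {a, b})"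
    using finitely_generated_invertible by blast
  then show thesis using invertible_ideal_pair a b that by blast
qed

lemma ideal_prod_split:
  assumes A: "ideal A R" and B: "ideal B R" and x: "x \<in> carrier R" and z: "z \<in> A \<cdot> B"
  shows "\<exists>s\<in>carrier R. \<exists>t\<in>carrier R. \<exists>w\<in>colon_ideal R A x \<cdot> B.
    s \<oplus> t = \<one> \<and> s \<otimes> x \<in> A \<and> t \<otimes> z = x \<otimes> w"
  using z
proof (induct rule: ideal_prod.induct)
  case (prod a b)
  have a: "a \<in> carrier R" and b: "b \<in> carrier R"
    using ideal.Icarr[OF A prod(1)] ideal.Icarr[OF B prod(2)] .
  obtain s t c d where st: "s \<in> carrier R" "t \<in> carrier R" "c \<in> carrier R" "d \<in> carrier R"
    "s \<oplus> t = \<one>" "s \<otimes> x = a \<otimes> c" "t \<otimes> a = x \<otimes> d"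
    using pair_split[OF x a] .
  have "s \<otimes> x \<in> A" using ideal.I_r_closed[OF A prod(1)] st by simp
  \<comment> \<open>Since \<open>d x = t a\<close> lies in \<open>A\<close>, \<open>d\<close> lies
    in \<open>(A : x)\<close>; the witness \<open>w\<close> is \<open>d b\<close>.\<close>
  moreover have "d \<otimes> x \<in> A"
    using ideal.I_l_closed[OF A prod(1) st(2)] st x by (simp add: m_comm)
  then have "d \<otimes> b \<in> colon_ideal R A x \<cdot> B"
    using st prod(2) by (intro ideal_prod.prod) (auto simp: colon_ideal_def)
  moreover have "t \<otimes> (a \<otimes> b) = x \<otimes> (d \<otimes> b)"
    using st x a b by (metis m_assoc)
  ultimately show ?case using st by blast
next
  case (sum z z')
  have C: "ideal (colon_ideal R A x \<cdot> B) R"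
    using ideal_prod_is_ideal[OF colon_ideal_is_ideal[OF A x] B] .
  have carr: "z \<in> carrier R" "z' \<in> carrier R"
    using sum ideal_prod_in_carrier[OF A B] by auto
  obtain s t w where 1: "s \<in> carrier R" "t \<in> carrier R" "w \<in> colon_ideal R A x \<cdot> B"
    "s \<oplus> t = \<one>" "s \<otimes> x \<in> A" "t \<otimes> z = x \<otimes> w" using sum by blast
  obtain s' t' w' where 2: "s' \<in> carrier R" "t' \<in> carrier R" "w' \<in> colon_ideal R A x \<cdot> B"
    "s' \<oplus> t' = \<one>" "s' \<otimes> x \<in> A" "t' \<otimes> z' = x \<otimes> w'" using sum by blast
  have w: "w \<in> carrier R" "w' \<in> carrier R" using 1 2 ideal.Icarr[OF C] by auto
  \<comment> \<open>Splitting the \<open>t\<close> part again by \<open>s' + t' = 1\<close> gives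
    the new pair \<open>s + t s'\<close> and \<open>t t'\<close>; the latter serves both
    summands.\<close>
  have "s \<oplus> t \<otimes> s' \<oplus> t \<otimes> t' = s \<oplus> t \<otimes> (s' \<oplus> t')"
    using 1(1,2) 2(1,2) by (simp add: r_distr a_assoc)
  also have "\<dots> = \<one>" using 1(2,4) 2(4) by simp
  finally have "s \<oplus> t \<otimes> s' \<oplus> t \<otimes> t' = \<one>" .
  moreover have "(s \<oplus> t \<otimes> s') \<otimes> x \<in> A"
    using 1 2 x by (simp add: l_distr m_assoc ideal_add[OF A] ideal.I_l_closed[OF A])
  moreover have "(t \<otimes> t') \<otimes> (z \<oplus> z') = x \<otimes> (t' \<otimes> w \<oplus> t \<otimes> w')"
  proof -
    have "(t \<otimes> t') \<otimes> (z \<oplus> z') = t' \<otimes> (t \<otimes> z) \<oplus> t \<otimes> (t' \<otimes> z')"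
      using 1(1,2) 2(1,2) carr by (simp add: r_distr m_ac)
    also have "\<dots> = t' \<otimes> (x \<otimes> w) \<oplus> t \<otimes> (x \<otimes> w')"
      using 1(6) 2(6) by simp
    also have "\<dots> = x \<otimes> (t' \<otimes> w \<oplus> t \<otimes> w')"
      using 1(1,2) 2(1,2) x w by (simp add: r_distr m_ac)
    finally show ?thesis .
  qed
  moreover have "t' \<otimes> w \<oplus> t \<otimes> w' \<in> colon_ideal R A x \<cdot> B"
    using 1 2 by (simp add: ideal_add[OF C] ideal.I_l_closed[OF C])
  moreover have "s \<oplus> t \<otimes> s' \<in> carrier R" "t \<otimes> t' \<in> carrier R" using 1 2 by auto
  ultimately show ?case by blast
qed

lemma idempotent_imp_radical:
  assumes "idempotent_ideal R I"
  shows "radical_ideal R I"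
proof (rule radicalI_square)
  show I: "ideal I R" using assms by (simp add: idempotent_ideal_def)
  fix x assume x: "x \<in> carrier R" and xx: "x \<otimes> x \<in> I"
  show "x \<in> I"
  proof (cases "x = \<zero>")
    case True
    then show ?thesis using ideal_zero[OF I] by simp
  next
    case False
    have C: "ideal (colon_ideal R I x) R" using colon_ideal_is_ideal[OF I x] .
    have "x \<otimes> x \<in> I \<cdot> I" using xx assms by (simp add: idempotent_ideal_def)
    then obtain s t w where st: "s \<in> carrier R" "t \<in> carrier R" "w \<in> colon_ideal R I x \<cdot> I"
      "s \<oplus> t = \<one>" "s \<otimes> x \<in> I" "t \<otimes> (x \<otimes> x) = x \<otimes> w"
      using ideal_prod_split[OF I I x] by blast
    \<comment> \<open>The product \<open>(I : x) I\<close> is contained in its second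
      factor.\<close>
    have w: "w \<in> I" using st(3) ideal_prod_inter[OF C I] by blast
    have "x \<otimes> (t \<otimes> x) = x \<otimes> w" using st x by (simp add: m_ac)
    then have "t \<otimes> x = w"
      using False st x ideal.Icarr[OF I w] by (simp add: m_lcancel)
    then have "s \<otimes> x \<oplus> t \<otimes> x \<in> I" using st(5) w ideal_add[OF I] by simp
    moreover have "s \<otimes> x \<oplus> t \<otimes> x = x" using st x by (simp add: l_distr[symmetric])
    ultimately show ?thesis by simp
  qed
qed

text \<open>In other words, \<open>P\<^sup>2\<close> is \<open>P\<close>-primary.\<close>

lemma primeideal_square_primary:
  assumes P: "primeideal P R" and u: "u \<in> carrier R - P" and x: "x \<in> P" and ux: "u \<otimes> x \<in> P \<cdot> P"
  shows "x \<in> P \<cdot> P"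
proof -
  have P': "ideal P R" using P primeideal.axioms(1) by blast
  have PP: "ideal (P \<cdot> P) R" using ideal_prod_is_ideal[OF P' P'] .
  have xc: "x \<in> carrier R" using ideal.Icarr[OF P' x] .
  \<comment> \<open>Since \<open>(P : u) = P\<close>, splitting \<open>u x\<close> against
    \<open>u\<close> puts \<open>w\<close> into \<open>P \<cdot> P\<close>.\<close>
  have colon: "colon_ideal R P u = P"
    using u primeideal.I_prime[OF P] ideal.Icarr[OF P'] ideal.I_r_closed[OF P']
    by (auto simp: colon_ideal_def)
  obtain s t w where st: "s \<in> carrier R" "t \<in> carrier R" "w \<in> P \<cdot> P"
    "s \<oplus> t = \<one>" "s \<otimes> u \<in> P" "t \<otimes> (u \<otimes> x) = u \<otimes> w"
    using ideal_prod_split[OF P' P' _ ux, of u] u colon by auto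
  have "s \<in> P" using primeideal.I_prime[OF P st(1) _ st(5)] u by auto
  then have sx: "s \<otimes> x \<in> P \<cdot> P" using x by (rule ideal_prod.prod)
  have "u \<noteq> \<zero>" using u ideal_zero[OF P'] by auto
  moreover have "u \<otimes> (t \<otimes> x) = u \<otimes> w" using st u xc by (simp add: m_ac)
  ultimately have "t \<otimes> x = w"
    using st u xc ideal.Icarr[OF PP] by (simp add: m_lcancel)
  then have "s \<otimes> x \<oplus> t \<otimes> x \<in> P \<cdot> P" using st(3) sx ideal_add[OF PP] by simp
  moreover have "s \<otimes> x \<oplus> t \<otimes> x = x" using st xc by (simp add: l_distr[symmetric])
  ultimately show ?thesis by simp
qed

lemma contraction_primeideal:
  assumes rad: "radical_ideal R I" and M: "primeideal M R" and IM: "I \<subseteq> M"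
  shows "primeideal (contraction R I M) R"
proof (rule primeidealI)
  have I: "ideal I R" using rad by (simp add: radical_ideal_def)
  show "ideal (contraction R I M) R" using contraction_ideal[OF I M] .
  show "cring R" by (rule is_cring)
  show "carrier R \<noteq> contraction R I M"
    using contraction_subset[OF M IM order_refl] one_notin_primeideal[OF M] by blast
  \<comment> \<open>If \<open>s a\<close> is a multiple of \<open>b\<close>, then
    \<open>(s u a)\<^sup>2\<close> is a multiple of \<open>u a b\<close>, and radicality removes the
    square.\<close>
  have root: "a \<in> contraction R I M"
    if u: "u \<in> carrier R - M" and s: "s \<in> carrier R - M"
      and carr: "a \<in> carrier R" "b \<in> carrier R" "c \<in> carrier R"
      and uab: "u \<otimes> (a \<otimes> b) \<in> I" and sa: "s \<otimes> a = b \<otimes> c" for u s a b c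
  proof -
    have "(s \<otimes> u \<otimes> a) \<otimes> (s \<otimes> u \<otimes> a) = (s \<otimes> u \<otimes> a \<otimes> u) \<otimes> (s \<otimes> a)"
      using u s carr by (simp add: m_ac)
    also have "\<dots> = (s \<otimes> u \<otimes> c) \<otimes> (u \<otimes> (a \<otimes> b))"
      unfolding sa using u s carr by (simp add: m_ac)
    also have "\<dots> \<in> I" using ideal.I_l_closed[OF I uab] u s carr by simp
    finally have "s \<otimes> u \<otimes> a \<in> I"
      using radical_ideal_square[OF rad, of "s \<otimes> u \<otimes> a"] u s carr by simp
    then show ?thesis
      using primeideal_compl_mult[OF M s u] carr by (auto simp: contraction_def)
  qed
  fix a b assume a: "a \<in> carrier R" and b: "b \<in> carrier R" and "a \<otimes> b \<in> contraction R I M"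
  then obtain u where u: "u \<in> carrier R - M" "u \<otimes> (a \<otimes> b) \<in> I"
    by (auto simp: contraction_def)
  obtain s t c d where st: "s \<in> carrier R" "t \<in> carrier R" "c \<in> carrier R" "d \<in> carrier R"
    "s \<oplus> t = \<one>" "s \<otimes> a = b \<otimes> c" "t \<otimes> b = a \<otimes> d"
    using pair_split[OF a b] .
  \<comment> \<open>As \<open>s + t = 1\<close>, one of them is a unit at \<open>M\<close>: locally,
    \<open>b\<close> divides \<open>a\<close> or \<open>a\<close> divides \<open>b\<close>. The two
    cases are symmetric.\<close>
  have "s \<notin> M \<or> t \<notin> M"
    using ideal_add[OF primeideal.axioms(1)[OF M], of s t] one_notin_primeideal[OF M] st(5) by auto
  moreover have "a \<in> contraction R I M" if "s \<notin> M"
    using root[OF u(1) _ a b st(3) u(2) st(6)] that st(1) by blast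
  moreover have "b \<in> contraction R I M" if "t \<notin> M"
    using root[OF u(1) _ b a st(4) _ st(7)] that st(2) u(2) m_comm[OF a b] by simp
  ultimately show "a \<in> contraction R I M \<or> b \<in> contraction R I M" by blast
qed

text \<open>A prime \<open>Q\<close> with \<open>I \<subseteq> Q \<subseteq> M\<close> contains the
  contraction by \<open>contraction_subset\<close>.\<close>

lemma contraction_minimal_prime:
  assumes "radical_ideal R I" "primeideal M R" "I \<subseteq> M"
  shows "minimal_prime R I (contraction R I M)"
  unfolding minimal_prime_def
proof (intro conjI allI impI)
  have sub: "contraction R I M \<subseteq> M" using contraction_subset assms by blast
  show "primeideal (contraction R I M) R" using contraction_primeideal assms .
  show "I \<subseteq> contraction R I M"
    using contraction_superset assms by (simp add: radical_ideal_def)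
  fix Q assume "primeideal Q R \<and> I \<subseteq> Q \<and> Q \<subseteq> contraction R I M"
  then show "Q = contraction R I M" using contraction_subset[of Q I M] sub by blast
qed

lemma idempotent_imp_minimal_prime_idempotent:
  assumes "idempotent_ideal R I" and P: "minimal_prime R I P"
  shows "idempotent_ideal R P"
proof -
  have I: "ideal I R" and II: "I = I \<cdot> I" using assms by (simp_all add: idempotent_ideal_def)
  have prime: "primeideal P R" and IP: "I \<subseteq> P" using P by (simp_all add: minimal_prime_def)
  then have P': "ideal P R" using primeideal.axioms(1) by blast
  have rad: "radical_ideal R I" using idempotent_imp_radical assms by blast
  \<comment> \<open>The contraction at \<open>P\<close> is a minimal prime of \<open>I\<close>
    inside \<open>P\<close>, so minimality of \<open>P\<close> forces equality.\<close>
  have "contraction R I P = P"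
    using P contraction_minimal_prime[OF rad prime IP] contraction_subset[OF prime IP order_refl]
    by (simp add: minimal_prime_def)
  moreover have "x \<in> P \<cdot> P" if xP: "x \<in> P" and x: "x \<in> contraction R I P" for x
  proof -
    obtain u where u: "u \<in> carrier R - P" "u \<otimes> x \<in> I" using x unfolding contraction_def by blast
    have "I \<cdot> I \<subseteq> P \<cdot> P"
    proof
      fix z assume "z \<in> I \<cdot> I"
      then show "z \<in> P \<cdot> P"
        by (induct rule: ideal_prod.induct) (use IP in \<open>auto intro: ideal_prod.intros\<close>)
    qed
    then show ?thesis using primeideal_square_primary[OF prime u(1) xP] u(2) II by blast
  qed
  ultimately have "P \<subseteq> P \<cdot> P" by blast
  then show ?thesis
    using P' ideal_prod_inter[OF P' P'] unfolding idempotent_ideal_def by blast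
qed

lemma radical_minimal_primes_imp_idempotent:
  assumes rad: "radical_ideal R I" and min: "\<And>P. minimal_prime R I P \<Longrightarrow> idempotent_ideal R P"
  shows "idempotent_ideal R I"
proof -
  have I: "ideal I R" using rad by (simp add: radical_ideal_def)
  have II: "ideal (I \<cdot> I) R" using ideal_prod_is_ideal[OF I I] .
  have "x \<in> I \<cdot> I" if x: "x \<in> I" for x
  proof (rule ccontr)
    assume "x \<notin> I \<cdot> I"
    have xc: "x \<in> carrier R" using ideal.Icarr[OF I x] .
    let ?C = "colon_ideal R (I \<cdot> I) x"
    have "\<one> \<notin> ?C" using \<open>x \<notin> I \<cdot> I\<close> xc by (simp add: colon_ideal_def)
    then obtain M where "maximalideal M R" and CM: "?C \<subseteq> M"
      using ex_maximalideal[OF colon_ideal_is_ideal[OF II xc]] by blast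
    then have M: "primeideal M R" using maximalideal_prime by blast
    \<comment> \<open>For \<open>r\<close> in \<open>I\<close>, both factors of \<open>r x\<close>
      are in \<open>I\<close>. This places \<open>I\<close> inside \<open>M\<close>, as the
      contraction lemmas require.\<close>
    have "I \<subseteq> ?C" using ideal.Icarr[OF I] x by (auto simp: colon_ideal_def intro: ideal_prod.prod)
    then have IM: "I \<subseteq> M" using CM by blast
    have "idempotent_ideal R (contraction R I M)"
      using min contraction_minimal_prime[OF rad M IM] .
    then have "x \<in> contraction R I M \<cdot> contraction R I M"
      using x contraction_superset[OF I M] by (auto simp: idempotent_ideal_def)
    then have "x \<in> contraction R (I \<cdot> I) M" using contraction_prod[OF I M] by blast
    \<comment> \<open>The multiplier \<open>u\<close> outside \<open>M\<close> with
      \<open>u x\<close> in \<open>I \<cdot> I\<close> would belong to \<open>?C\<close>, hence to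
      \<open>M\<close>.\<close>
    then show False using CM by (auto simp: contraction_def colon_ideal_def)
  qed
  then show ?thesis
    using I ideal_prod_inter[OF I I] unfolding idempotent_ideal_def by blast
qed

end

theorem theorem2p9:
  fixes D (structure)
  assumes "prufer_domain D" and "ideal I D"
  shows "idempotent_ideal D I \<longleftrightarrow>
    radical_ideal D I \<and> (\<forall>P. minimal_prime D I P \<longrightarrow> idempotent_ideal D P)"
proof -
  interpret prufer_domain D by fact
  show ?thesis
    using idempotent_imp_radical idempotent_imp_minimal_prime_idempotent
      radical_minimal_primes_imp_idempotent by blast
qed

end
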